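(* Let $n\geq 4$ and let $S_n$ be the $n$-sunlet graph. Then $\psi_E(S_n)=3$.
   Context: All graphs are simple, connected and undirected. The $n$-sunlet graph $S_n$ is obtained from the cycle $C_n$ by attaching one pendant edge at each vertex of the cycle (so it has $n$ cycle edges and $n$ pendant edges). For a graph $G$, the edge distance $d_E(f,g)$ between edges $f,g\in E(G)$ is the distance between $f$ and $g$ as vertices of the line graph $L(G)$. Two edges $f,g$ are said to edge doubly resolve edges $f_1,f_2$ if $d_E(f_1,f)-d_E(f_1,g)\neq d_E(f_2,f)-d_E(f_2,g)$. A set $D_E\subseteq E(G)$ is an edge version of doubly resolving set of $G$ if every pair of distinct edges $e\neq f$ of $G$ is edge doubly resolved by some two edges of $D_E$. $\psi_E(G)$ denotes the minimum cardinality of an edge version of doubly resolving set of $G$. *)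

theory Defs
  imports Main
begin

text \<open>An undirected graph is a pair of a vertex set and a set of edges, an edge being the
  two-element set of its end vertices.\<close>

type_synonym 'a ugraph = "'a set \<times> 'a set set"

definition verts :: "'a ugraph \<Rightarrow> 'a set" where
  "verts G = fst G"

definition edges :: "'a ugraph \<Rightarrow> 'a set set" where
  "edges G = snd G"

definition simple_graph :: "'a ugraph \<Rightarrow> bool" where
  "simple_graph G \<longleftrightarrow> finite (verts G) \<and> (\<forall>e\<in>edges G. e \<subseteq> verts G \<and> card e = 2)"

definition is_walk :: "'a ugraph \<Rightarrow> 'a \<Rightarrow> 'a list \<Rightarrow> 'a \<Rightarrow> bool" where
  "is_walk G u xs v \<longleftrightarrow>
     xs \<noteq> [] \<and> hd xs = u \<and> last xs = v \<and> set xs \<subseteq> verts G \<and>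
     (\<forall>i. Suc i < length xs \<longrightarrow> {xs ! i, xs ! Suc i} \<in> edges G)"

definition connected_graph :: "'a ugraph \<Rightarrow> bool" where
  "connected_graph G \<longleftrightarrow>
     verts G \<noteq> {} \<and> (\<forall>u\<in>verts G. \<forall>v\<in>verts G. \<exists>xs. is_walk G u xs v)"

text \<open>The length of a walk is its number of edges. The distance is meaningful only between
  vertices joined by a walk, in particular in connected graphs.\<close>

definition graph_dist :: "'a ugraph \<Rightarrow> 'a \<Rightarrow> 'a \<Rightarrow> nat" where
  "graph_dist G u v = (LEAST k. \<exists>xs. is_walk G u xs v \<and> length xs = Suc k)"

definition line_graph :: "'a ugraph \<Rightarrow> 'a set ugraph" where
  "line_graph G =
     (edges G, {{e, f} | e f. e \<in> edges G \<and> f \<in> edges G \<and> e \<noteq> f \<and> e \<inter> f \<noteq> {}})"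

definition edge_dist :: "'a ugraph \<Rightarrow> 'a set \<Rightarrow> 'a set \<Rightarrow> nat" where
  "edge_dist G f g = graph_dist (line_graph G) f g"

text \<open>The differences below are taken in \<^typ>\<open>int\<close>, since subtraction on \<^typ>\<open>nat\<close> truncates.\<close>

definition edge_doubly_resolve ::
  "'a ugraph \<Rightarrow> 'a set \<Rightarrow> 'a set \<Rightarrow> 'a set \<Rightarrow> 'a set \<Rightarrow> bool" where
  "edge_doubly_resolve G f g f1 f2 \<longleftrightarrow>
     int (edge_dist G f1 f) - int (edge_dist G f1 g) \<noteq>
     int (edge_dist G f2 f) - int (edge_dist G f2 g)"

definition edge_doubly_resolving_set :: "'a ugraph \<Rightarrow> 'a set set \<Rightarrow> bool" where
  "edge_doubly_resolving_set G D \<longleftrightarrow>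
     D \<subseteq> edges G \<and>
     (\<forall>e\<in>edges G. \<forall>f\<in>edges G. e \<noteq> f \<longrightarrow>
        (\<exists>d1\<in>D. \<exists>d2\<in>D. edge_doubly_resolve G d1 d2 e f))"

definition psi_E :: "'a ugraph \<Rightarrow> nat" where
  "psi_E G = (LEAST k. \<exists>D. edge_doubly_resolving_set G D \<and> card D = k)"

text \<open>The cycle vertices of the sunlet graph are \<open>Cyc i\<close>, and \<open>Pend i\<close> is the
  leaf attached to \<open>Cyc i\<close>. The definition describes the sunlet graph for \<open>n \<ge> 3\<close>
  (a simple cycle needs at least three vertices).\<close>

datatype sunlet_vertex = Cyc nat | Pend nat

definition sunlet :: "nat \<Rightarrow> sunlet_vertex ugraph" where
  "sunlet n =
     (Cyc ` {..<n} \<union> Pend ` {..<n},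
      {{Cyc i, Cyc ((i + 1) mod n)} | i. i < n} \<union> {{Cyc i, Pend i} | i. i < n})"

lemma simple_graph_sunlet:
  assumes "n \<ge> 2"
  shows "simple_graph (sunlet n)"
proof -
  have "i \<noteq> (i + 1) mod n" if "i < n" for i
    using that assms by (cases "i + 1 = n") auto
  then show ?thesis
    by (auto simp: simple_graph_def sunlet_def verts_def edges_def)
qed

lemma is_walk_snoc:
  assumes "is_walk G u xs v" "{v, w} \<in> edges G" "w \<in> verts G"
  shows "is_walk G u (xs @ [w]) w"
proof -
  have "{(xs @ [w]) ! i, (xs @ [w]) ! Suc i} \<in> edges G" if "Suc i < length (xs @ [w])" for i
  proof (cases "Suc i < length xs")
    case True
    then show ?thesis using assms(1) by (simp add: is_walk_def nth_append)
  next
    case False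
    then have i: "Suc i = length xs" using that by auto
    have "xs \<noteq> []" "last xs = v" using assms(1) by (auto simp: is_walk_def)
    then have "xs ! i = v" using i by (metis diff_Suc_1 last_conv_nth)
    then show ?thesis using assms(2) i by (simp add: nth_append)
  qed
  then show ?thesis using assms by (simp add: is_walk_def)
qed

lemma connected_graph_sunlet:
  assumes "n \<ge> 1"
  shows "connected_graph (sunlet n)"
proof -
  let ?G = "sunlet n"
  have cyc: "{Cyc i, Cyc ((i + 1) mod n)} \<in> edges ?G" if "i < n" for i
    using that by (auto simp: sunlet_def edges_def)
  have pend: "{Cyc i, Pend i} \<in> edges ?G" if "i < n" for i
    using that by (auto simp: sunlet_def edges_def)
  have vC: "Cyc i \<in> verts ?G" and vP: "Pend i \<in> verts ?G" if "i < n" for i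
    using that by (auto simp: sunlet_def verts_def)
  have step: "\<exists>xs. is_walk ?G u xs (Cyc ((i + k) mod n))"
    if "\<exists>xs. is_walk ?G u xs (Cyc i)" "i < n" for u i k
  proof (induction k)
    case 0
    then show ?case using that by simp
  next
    case (Suc k)
    let ?j = "(i + k) mod n"
    obtain xs where xs: "is_walk ?G u xs (Cyc ?j)" using Suc by blast
    have "?j < n" "(?j + 1) mod n < n" using assms by simp_all
    then have "is_walk ?G u (xs @ [Cyc ((?j + 1) mod n)]) (Cyc ((?j + 1) mod n))"
      by (intro is_walk_snoc[OF xs cyc vC])
    moreover have "(?j + 1) mod n = (i + Suc k) mod n" by (simp add: mod_Suc_eq)
    ultimately show ?case by metis
  qed
  have cycs: "\<exists>xs. is_walk ?G u xs (Cyc j)"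
    if "\<exists>xs. is_walk ?G u xs (Cyc i)" "i < n" "j < n" for u i j
    using step[OF that(1,2), of "n - i + j"] that(2,3) by simp
  have start: "\<exists>i<n. \<exists>xs. is_walk ?G u xs (Cyc i)" if u: "u \<in> verts ?G" for u
  proof (cases u)
    case (Cyc i)
    then have "i < n" using u by (auto simp: sunlet_def verts_def)
    moreover have "is_walk ?G u [u] (Cyc i)" using u Cyc by (simp add: is_walk_def)
    ultimately show ?thesis by blast
  next
    case (Pend i)
    then have "i < n" using u by (auto simp: sunlet_def verts_def)
    have w: "is_walk ?G u [u] (Pend i)" using u Pend by (simp add: is_walk_def)
    have "{Pend i, Cyc i} \<in> edges ?G" using pend[OF \<open>i < n\<close>] by (simp add: insert_commute)
    from is_walk_snoc[OF w this vC[OF \<open>i < n\<close>]] \<open>i < n\<close> show ?thesis by blast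
  qed
  have "\<exists>xs. is_walk ?G u xs v" if u: "u \<in> verts ?G" and v: "v \<in> verts ?G" for u v
  proof (cases v)
    case (Cyc j)
    then have "j < n" using v by (auto simp: sunlet_def verts_def)
    obtain i where "i < n" "\<exists>xs. is_walk ?G u xs (Cyc i)" using start[OF u] by blast
    from cycs[OF this(2,1) \<open>j < n\<close>] show ?thesis using Cyc by simp
  next
    case (Pend j)
    then have "j < n" using v by (auto simp: sunlet_def verts_def)
    obtain i where "i < n" "\<exists>xs. is_walk ?G u xs (Cyc i)" using start[OF u] by blast
    from cycs[OF this(2,1) \<open>j < n\<close>] obtain xs where "is_walk ?G u xs (Cyc j)" by blast
    from is_walk_snoc[OF this pend[OF \<open>j < n\<close>] vP[OF \<open>j < n\<close>]] show ?thesis using Pend by blast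
  qed
  moreover have "verts ?G \<noteq> {}" using vC[of 0] assms by auto
  ultimately show ?thesis by (simp add: connected_graph_def)
qed

end

theory Submission
  imports Defs
begin

text \<open>Lower bound: for two landmark edges \<open>a\<close>, \<open>b\<close> the difference \<open>d(e,a) - d(e,b)\<close> must be
  injective in \<open>e\<close>, but the line graph has \<open>2n\<close> vertices and diameter at most
  \<open>\<lfloor>n/2\<rfloor> + 1\<close>, so there are at most \<open>2\<lfloor>n/2\<rfloor> + 3 < 2n\<close> differences when \<open>n \<ge> 4\<close>.
  Upper bound: with cycle edges \<open>c\<^sub>i = {i, i+1}\<close> and pendant edges \<open>p\<^sub>i\<close>, the set
  \<open>{c\<^sub>0, c\<^bsub>\<lfloor>n/2\<rfloor>\<^esub>, p\<^sub>0}\<close> is doubly resolving, by the explicit formula for edge distances.\<close>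

section \<open>Distances from potential functions\<close>

text \<open>The potential drops by at most one along each edge, so a walk to \<open>v\<close> has at
  least \<open>\<phi> u\<close> edges. The inequality is strict because \<open>length xs\<close>
  counts vertices.\<close>

lemma walk_length_ge_potential:
  fixes \<phi> :: "'a \<Rightarrow> nat"
  assumes "\<And>x y. x \<in> verts G \<Longrightarrow> y \<in> verts G \<Longrightarrow> {x, y} \<in> edges G \<Longrightarrow> \<phi> x \<le> Suc (\<phi> y)"
    and "is_walk G u xs v" and "\<phi> v = 0"
  shows "\<phi> u < length xs"
  using assms(2)
proof (induction xs arbitrary: u)
  case Nil
  then show ?case by (simp add: is_walk_def)
next
  case (Cons x xs)
  have x: "x = u" using Cons.prems by (simp add: is_walk_def)
  show ?case
  proof (cases xs)
    case Nil
    then have "u = v" using Cons.prems by (auto simp: is_walk_def)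
    then show ?thesis using assms(3) by simp
  next
    case (Cons y ys)
    have edge: "{(x # xs) ! i, (x # xs) ! Suc i} \<in> edges G" if "Suc i < length (x # xs)" for i
      using Cons.prems that by (auto simp: is_walk_def)
    have "{u, y} \<in> edges G" using edge[of 0] x Cons by simp
    moreover have "u \<in> verts G" "y \<in> verts G" using Cons.prems x Cons by (auto simp: is_walk_def)
    ultimately have "\<phi> u \<le> Suc (\<phi> y)" using assms(1) by blast
    moreover have "is_walk G y xs v"
      using Cons.prems Cons edge[of "Suc i" for i] by (simp add: is_walk_def)
    then have "\<phi> y < length xs" by (rule Cons.IH)
    ultimately show ?thesis by simp
  qed
qed

lemma is_walk_Cons:
  assumes "is_walk G w xs v" "{u, w} \<in> edges G" "u \<in> verts G"
  shows "is_walk G u (u # xs) v"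
proof -
  have "{(u # xs) ! i, (u # xs) ! Suc i} \<in> edges G" if "Suc i < length (u # xs)" for i
    using that assms by (cases i) (auto simp: is_walk_def hd_conv_nth)
  then show ?thesis using assms by (simp add: is_walk_def)
qed

lemma walk_of_potential:
  fixes \<phi> :: "'a \<Rightarrow> nat"
  assumes "\<And>x. x \<in> verts G \<Longrightarrow> x \<noteq> v \<Longrightarrow> \<exists>y\<in>verts G. {x, y} \<in> edges G \<and> \<phi> x = Suc (\<phi> y)"
    and "u \<in> verts G" "\<phi> v = 0"
  shows "\<exists>xs. is_walk G u xs v \<and> length xs = Suc (\<phi> u)"
  using assms(2)
proof (induction "\<phi> u" arbitrary: u rule: less_induct)
  case less
  show ?case
  proof (cases "u = v")
    case True
    then have "is_walk G u [u] v" using less.prems by (simp add: is_walk_def)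
    then show ?thesis using True assms(3) by (metis length_Cons list.size(3))
  next
    case False
    obtain y where y: "y \<in> verts G" "{u, y} \<in> edges G" "\<phi> u = Suc (\<phi> y)"
      using assms(1)[OF less.prems False] by blast
    then obtain xs where "is_walk G y xs v" "length xs = Suc (\<phi> y)"
      using less.hyps[of y] by auto
    then show ?thesis using is_walk_Cons[OF _ y(2) less.prems] y(3) by (metis length_Cons)
  qed
qed

text \<open>Turns a distance computation into local checks: the first condition bounds every walk
  from below, and the second lets greedy descent reach \<open>v\<close> in exactly
  \<open>\<phi> u\<close> steps.\<close>

lemma graph_dist_eq_potential:
  fixes \<phi> :: "'a \<Rightarrow> nat"
  assumes "\<And>x y. x \<in> verts G \<Longrightarrow> y \<in> verts G \<Longrightarrow> {x, y} \<in> edges G \<Longrightarrow> \<phi> x \<le> Suc (\<phi> y)"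
    and "\<And>x. x \<in> verts G \<Longrightarrow> x \<noteq> v \<Longrightarrow> \<exists>y\<in>verts G. {x, y} \<in> edges G \<and> \<phi> x = Suc (\<phi> y)"
    and "u \<in> verts G" "\<phi> v = 0"
  shows "graph_dist G u v = \<phi> u"
  unfolding graph_dist_def
proof (rule Least_equality)
  show "\<exists>xs. is_walk G u xs v \<and> length xs = Suc (\<phi> u)"
    using assms(2-4) by (rule walk_of_potential)
next
  fix k assume "\<exists>xs. is_walk G u xs v \<and> length xs = Suc k"
  then obtain xs where xs: "is_walk G u xs v" "length xs = Suc k" by blast
  have "\<phi> u < length xs" using assms(1) xs(1) assms(4) by (rule walk_length_ge_potential)
  then show "\<phi> u \<le> k" using xs(2) by simp
qed

lemma line_graph_edge_iff:
  "{e, f} \<in> edges (line_graph G) \<longleftrightarrow>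
    e \<in> edges G \<and> f \<in> edges G \<and> e \<noteq> f \<and> e \<inter> f \<noteq> {}"
proof -
  have line: "edges (line_graph G) =
      {{e, f} | e f. e \<in> edges G \<and> f \<in> edges G \<and> e \<noteq> f \<and> e \<inter> f \<noteq> {}}"
    by (simp add: line_graph_def edges_def[of "(_, _)"])
  show ?thesis (is "?L \<longleftrightarrow> ?R")
  proof
    assume ?L
    then obtain e' f' where "{e, f} = {e', f'}"
      and ef: "e' \<in> edges G" "f' \<in> edges G" "e' \<noteq> f'" "e' \<inter> f' \<noteq> {}"
      unfolding line by blast
    then have "e = e' \<and> f = f' \<or> e = f' \<and> f = e'" by (simp only: doubleton_eq_iff)
    with ef show ?R by (elim disjE conjE) (simp_all add: Int_commute)
  next
    assume ?R
    then show ?L unfolding line mem_Collect_eq by (intro exI[of _ e] exI[of _ f]) simp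
  qed
qed

section \<open>Edge distances in the sunlet graph\<close>

text \<open>Edges are indexed by vertices: \<open>Cyc i\<close> stands for the cycle edge leaving vertex \<open>i\<close>
  clockwise, \<open>Pend i\<close> for the pendant edge at \<open>i\<close>.\<close>

primrec sunlet_edge :: "nat \<Rightarrow> sunlet_vertex \<Rightarrow> sunlet_vertex set" where
  "sunlet_edge n (Cyc i) = {Cyc i, Cyc ((i + 1) mod n)}"
| "sunlet_edge n (Pend i) = {Cyc i, Pend i}"

declare sunlet_edge.simps [simp del]

text \<open>For \<open>i, j < n\<close> this is (j - i) modulo \<open>n\<close>, put as a case split
  to suit linear arithmetic.\<close>

definition clockwise :: "nat \<Rightarrow> nat \<Rightarrow> nat \<Rightarrow> nat" where
  "clockwise n i j = (if i \<le> j then j - i else n + j - i)"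

text \<open>Each \<open>min\<close> compares the two directions around the cycle. The mixed cases
  are lopsided because \<open>Pend i\<close> touches \<open>Cyc i\<close> and the cycle edge before
  it: going clockwise to \<open>Cyc j\<close> costs one extra step, while going backwards ends at
  the far end of \<open>Cyc j\<close>.\<close>

fun sunlet_dist :: "nat \<Rightarrow> sunlet_vertex \<Rightarrow> sunlet_vertex \<Rightarrow> nat" where
  "sunlet_dist n (Cyc i) (Cyc j) = min (clockwise n i j) (n - clockwise n i j)"
| "sunlet_dist n (Pend i) (Cyc j) = min (clockwise n i j + 1) (n - clockwise n i j)"
| "sunlet_dist n (Cyc i) (Pend j) = min (clockwise n j i + 1) (n - clockwise n j i)"
| "sunlet_dist n (Pend i) (Pend j) =
     (if i = j then 0 else min (clockwise n i j) (n - clockwise n i j) + 1)"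

lemma verts_sunlet: "verts (sunlet n) = Cyc ` {..<n} \<union> Pend ` {..<n}"
  by (simp add: sunlet_def verts_def)

lemma edges_sunlet: "edges (sunlet n) = sunlet_edge n ` verts (sunlet n)"
  by (auto simp: sunlet_def edges_def verts_def sunlet_edge.simps image_Un image_image)

section \<open>Injectivity of the edge indexing and adjacency of edges\<close>

lemma Suc_mod_if: "i < n \<Longrightarrow> Suc i mod n = (if Suc i = n then 0 else Suc i)"
  by simp

lemma Suc_mod_eq_iff: "i < n \<Longrightarrow> j < n \<Longrightarrow> Suc i mod n = Suc j mod n \<longleftrightarrow> i = j"
  by (auto simp: Suc_mod_if split: if_splits)

text \<open>For \<open>n = 2\<close> the two cycle edges would coincide.\<close>

lemma inj_on_sunlet_edge:
  assumes "n \<ge> 3"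
  shows "inj_on (sunlet_edge n) (verts (sunlet n))"
proof (rule inj_onI)
  fix x y assume "x \<in> verts (sunlet n)" "y \<in> verts (sunlet n)" "sunlet_edge n x = sunlet_edge n y"
  then show "x = y" using assms
    by (cases x; cases y)
      (auto simp: verts_sunlet sunlet_edge.simps doubleton_eq_iff Suc_mod_if split: if_splits)
qed

text \<open>Pendant edges never meet each other, so each adjacency can be recorded from a cycle
  edge, the earlier one clockwise if there are two. The relation is one-sided and is used together
  with its converse.\<close>

definition cyclic_adjacent :: "nat \<Rightarrow> sunlet_vertex \<Rightarrow> sunlet_vertex \<Rightarrow> bool" where
  "cyclic_adjacent n x y \<longleftrightarrow>
    (\<exists>i<n. x = Cyc i \<and> y \<in> {Cyc i, Cyc (Suc i mod n), Pend i, Pend (Suc i mod n)})"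

lemma sunlet_edges_meet:
  assumes "x \<in> verts (sunlet n)" "y \<in> verts (sunlet n)" "x \<noteq> y"
  shows "sunlet_edge n x \<inter> sunlet_edge n y \<noteq> {} \<longleftrightarrow> cyclic_adjacent n x y \<or> cyclic_adjacent n y x"
proof -
  \<comment> \<open>The successor modulo \<open>n\<close> is kept opaque, so that comparing end
    vertices uses only its injectivity below \<open>n\<close>.\<close>
  define s where "s i = Suc i mod n" for i
  have s: "Suc i mod n = s i" for i by (simp add: s_def)
  have inj: "s i = s j \<longleftrightarrow> i = j" if "i < n" "j < n" for i j
    using that by (simp add: s_def Suc_mod_eq_iff)
  obtain i where i: "i < n" "x = Cyc i \<or> x = Pend i" using assms(1) by (auto simp: verts_sunlet)
  obtain j where j: "j < n" "y = Cyc j \<or> y = Pend j" using assms(2) by (auto simp: verts_sunlet)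
  show ?thesis
    using i(2) j(2) assms(3)
    by (elim disjE) (simp_all add: sunlet_edge.simps cyclic_adjacent_def s i(1) j(1) inj[OF i(1) j(1)]
      conj_disj_distribL ex_disj_distrib eq_commute)
qed

text \<open>Normalises all positions near \<open>i\<close> relative to \<open>j\<close> to the
  single number \<open>k\<close>, so that later case analyses are linear arithmetic in
  \<open>k\<close> and \<open>n\<close>.\<close>

lemma clockwise_from:
  assumes "n \<ge> 3" "i < n" "j < n"
  defines "k \<equiv> clockwise n i j"
  shows "k < n" "i = j \<longleftrightarrow> k = 0" "Suc i mod n = j \<longleftrightarrow> k = 1"
    "clockwise n j i = (if k = 0 then 0 else n - k)"
    "clockwise n (Suc i mod n) j = (if k = 0 then n - 1 else k - 1)"
    "clockwise n j (Suc i mod n) = (if k = 0 then 1 else if k = 1 then 0 else n - (k - 1))"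
  using assms by (auto simp: clockwise_def Suc_mod_if)

lemma clockwise_from_pred:
  assumes "n \<ge> 3" "p < n" "j < n"
  defines "k \<equiv> clockwise n (Suc p mod n) j"
  shows "p = j \<longleftrightarrow> k = n - 1"
    "clockwise n p j = (if k = n - 1 then 0 else Suc k)"
    "clockwise n j p = (if k = n - 1 then 0 else n - Suc k)"
  using assms by (auto simp: clockwise_def Suc_mod_if)

lemma cyclic_adjacent_dist:
  assumes "n \<ge> 3" "cyclic_adjacent n x y" "z \<in> verts (sunlet n)"
  shows "sunlet_dist n x z \<le> Suc (sunlet_dist n y z) \<and> sunlet_dist n y z \<le> Suc (sunlet_dist n x z)"
proof -
  obtain i where i: "i < n" "x = Cyc i"
      "y \<in> {Cyc i, Cyc (Suc i mod n), Pend i, Pend (Suc i mod n)}"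
    using assms(2) by (auto simp: cyclic_adjacent_def)
  obtain j where j: "j < n" "z = Cyc j \<or> z = Pend j" using assms(3) by (auto simp: verts_sunlet)
  define k where "k = clockwise n i j"
  note k = clockwise_from[OF assms(1) i(1) j(1), folded k_def] k_def[symmetric]
  show ?thesis using i(2,3) j(2) k(1) assms(1)
    by (auto simp: k(2-) min_def)
qed

lemma sunlet_dist_lipschitz:
  assumes "n \<ge> 3" "x \<in> verts (sunlet n)" "y \<in> verts (sunlet n)" "z \<in> verts (sunlet n)"
    and "sunlet_edge n x \<inter> sunlet_edge n y \<noteq> {}"
  shows "sunlet_dist n x z \<le> Suc (sunlet_dist n y z)"
  using cyclic_adjacent_dist[OF assms(1) _ assms(4)] sunlet_edges_meet[OF assms(2,3)] assms(5)
  by (cases "x = y") auto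

lemma sunlet_dist_descent:
  assumes n: "n \<ge> 3" and x: "x \<in> verts (sunlet n)" and z: "z \<in> verts (sunlet n)" and "x \<noteq> z"
  shows "\<exists>y\<in>verts (sunlet n). y \<noteq> x \<and> sunlet_edge n x \<inter> sunlet_edge n y \<noteq> {}
    \<and> sunlet_dist n x z = Suc (sunlet_dist n y z)"
proof -
  obtain i where i: "i < n" "x = Cyc i \<or> x = Pend i" using x by (auto simp: verts_sunlet)
  obtain j where j: "j < n" "z = Cyc j \<or> z = Pend j" using z by (auto simp: verts_sunlet)
  define p where "p = (if i = 0 then n - 1 else i - 1)"
  have p: "p < n" "Suc p mod n = i" "p \<noteq> i" "Suc i mod n \<noteq> i" "Suc i mod n < n"
    using i(1) n by (auto simp: p_def Suc_mod_if)
  define k where "k = clockwise n i j"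
  note k = clockwise_from[OF n i(1) j(1), folded k_def]
    clockwise_from_pred[OF n p(1) j(1), unfolded p(2), folded k_def] k_def[symmetric]
  \<comment> \<open>\<open>y\<close> is the next edge on a shortest route: clockwise while that way
    is no longer, otherwise back through the predecessor \<open>p\<close>. For a pendant target,
    \<open>k = 0\<close> and \<open>k = 1\<close> mean that it hangs at an end of
    \<open>Cyc i\<close>.\<close>
  define y where "y =
    (case (x, z) of
       (Cyc _, Cyc _) \<Rightarrow> if 2 * k \<le> n then Cyc (Suc i mod n) else Cyc p
     | (Cyc _, Pend _) \<Rightarrow> if k = 0 then Pend i else if k = 1 then Pend j
         else if 2 * k \<le> n then Cyc (Suc i mod n) else Cyc p
     | (Pend _, _) \<Rightarrow> if 2 * k < n then Cyc i else Cyc p)"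
  have "sunlet_dist n x z = Suc (sunlet_dist n y z)"
    using i(2) j(2) k(1) n \<open>x \<noteq> z\<close>
    by (elim disjE) (simp_all add: y_def k(2-), auto simp: min_def)
  moreover have "y \<in> verts (sunlet n)" "y \<noteq> x" "cyclic_adjacent n x y \<or> cyclic_adjacent n y x"
    using i j p k(3)
    by (auto simp: y_def verts_sunlet cyclic_adjacent_def split: if_splits)
  ultimately show ?thesis using sunlet_edges_meet[OF x] by blast
qed

lemma edge_dist_sunlet:
  assumes n: "n \<ge> 3" and u: "u \<in> verts (sunlet n)" and v: "v \<in> verts (sunlet n)"
  shows "edge_dist (sunlet n) (sunlet_edge n u) (sunlet_edge n v) = sunlet_dist n u v"
proof -
  let ?V = "verts (sunlet n)" and ?E = "sunlet_edge n"
  \<comment> \<open>A potential on the line graph takes edges as sets; injectivity of the indexing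
    recovers the index.\<close>
  define \<phi> where "\<phi> e = sunlet_dist n (inv_into ?V ?E e) v" for e
  have \<phi>: "\<phi> (?E x) = sunlet_dist n x v" if "x \<in> ?V" for x
    using inj_on_sunlet_edge[OF n] that by (simp add: \<phi>_def)
  have verts: "verts (line_graph (sunlet n)) = ?E ` ?V"
    by (simp add: line_graph_def verts_def[of "(_, _)"] edges_sunlet)
  have adj: "{?E x, ?E y} \<in> edges (line_graph (sunlet n)) \<longleftrightarrow>
      ?E x \<inter> ?E y \<noteq> {} \<and> x \<noteq> y" if "x \<in> ?V" "y \<in> ?V" for x y
    using that inj_on_eq_iff[OF inj_on_sunlet_edge[OF n]]
    by (auto simp: line_graph_edge_iff edges_sunlet)
  have "graph_dist (line_graph (sunlet n)) (?E u) (?E v) = \<phi> (?E u)"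
  proof (rule graph_dist_eq_potential)
    fix e f assume "e \<in> verts (line_graph (sunlet n))" "f \<in> verts (line_graph (sunlet n))"
      and "{e, f} \<in> edges (line_graph (sunlet n))"
    then show "\<phi> e \<le> Suc (\<phi> f)"
      using sunlet_dist_lipschitz[OF n _ _ v] by (auto simp: verts adj \<phi>)
  next
    fix e assume "e \<in> verts (line_graph (sunlet n))" "e \<noteq> ?E v"
    then obtain x where x: "x \<in> ?V" "x \<noteq> v" "e = ?E x" by (auto simp: verts)
    obtain y where "y \<in> ?V" "y \<noteq> x" "?E x \<inter> ?E y \<noteq> {}"
        "sunlet_dist n x v = Suc (sunlet_dist n y v)"
      using sunlet_dist_descent[OF n x(1) v x(2)] by blast
    then show "\<exists>f\<in>verts (line_graph (sunlet n)).
        {e, f} \<in> edges (line_graph (sunlet n)) \<and> \<phi> e = Suc (\<phi> f)"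
      using x by (intro bexI[of _ "?E y"]) (auto simp: verts adj \<phi>)
  next
    show "?E u \<in> verts (line_graph (sunlet n))" using u by (simp add: verts)
    show "\<phi> (?E v) = 0" using v by (cases v) (auto simp: \<phi> clockwise_def)
  qed
  then show ?thesis using u by (simp add: edge_dist_def \<phi>)
qed

section \<open>Diameter bound and number of edges\<close>

lemma sunlet_dist_le: "sunlet_dist n u v \<le> n div 2 + 1"
proof -
  have le: "min k (n - k) \<le> n div 2" "min (k + 1) (n - k) \<le> n div 2 + 1" for k
    unfolding min_le_iff_disj by linarith+
  show ?thesis
    by (cases u; cases v)
      (simp_all only: sunlet_dist.simps le trans_le_add1 add_le_mono1 zero_le simp_thms split: if_split)
qed

lemma card_edges_sunlet:
  assumes "n \<ge> 3"
  shows "finite (edges (sunlet n))" "card (edges (sunlet n)) = 2 * n"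
proof -
  have "card (verts (sunlet n)) = n + n"
    unfolding verts_sunlet by (subst card_Un_disjoint) (auto simp: card_image inj_on_def)
  then show "card (edges (sunlet n)) = 2 * n"
    by (simp add: edges_sunlet card_image[OF inj_on_sunlet_edge[OF assms]])
  show "finite (edges (sunlet n))" by (simp add: edges_sunlet verts_sunlet)
qed

section \<open>Doubly resolving sets of the sunlet graph\<close>

text \<open>Since \<open>a = b\<close> is allowed and \<open>D\<close> may be smaller than
  \<open>{a, b}\<close>, this rules out all sets of at most two edges.\<close>

lemma not_doubly_resolving_pair:
  assumes n: "n \<ge> 4" and a: "a \<in> edges (sunlet n)" and b: "b \<in> edges (sunlet n)"
    and "D \<subseteq> {a, b}"
  shows "\<not> edge_doubly_resolving_set (sunlet n) D"
proof
  let ?G = "sunlet n" and ?m = "int (n div 2 + 1)"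
  assume D: "edge_doubly_resolving_set ?G D"
  define \<delta> where "\<delta> e = int (edge_dist ?G e a) - int (edge_dist ?G e b)" for e
  have "inj_on \<delta> (edges ?G)"
  proof (rule inj_onI, rule ccontr)
    fix e f assume "e \<in> edges ?G" "f \<in> edges ?G" "\<delta> e = \<delta> f" "e \<noteq> f"
    then obtain d1 d2 where "d1 \<in> D" "d2 \<in> D" "edge_doubly_resolve ?G d1 d2 e f"
      using D unfolding edge_doubly_resolving_set_def by metis
    moreover from this have "d1 = a \<or> d1 = b" "d2 = a \<or> d2 = b" using assms(4) by auto
    \<comment> \<open>Equal landmarks resolve nothing, and exchanging \<open>a\<close> and
      \<open>b\<close> only changes the sign of the difference.\<close>
    ultimately show False using \<open>\<delta> e = \<delta> f\<close> by (auto simp: edge_doubly_resolve_def \<delta>_def)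
  qed
  then have "card (edges ?G) = card (\<delta> ` edges ?G)" by (simp add: card_image)
  also have "\<dots> \<le> card {- ?m..?m}"
  proof (rule card_mono)
    have le: "edge_dist ?G e f \<le> n div 2 + 1" if ef: "e \<in> edges ?G" "f \<in> edges ?G" for e f
    proof -
      obtain u v where "u \<in> verts ?G" "v \<in> verts ?G" "e = sunlet_edge n u" "f = sunlet_edge n v"
        using ef by (auto simp: edges_sunlet)
      then show ?thesis using edge_dist_sunlet[of n u v] sunlet_dist_le[of n u v] n by simp
    qed
    show "\<delta> ` edges ?G \<subseteq> {- ?m..?m}"
    proof (rule image_subsetI)
      fix e assume "e \<in> edges ?G"
      from le[OF this a] le[OF this b] show "\<delta> e \<in> {- ?m..?m}" by (simp add: \<delta>_def)
    qed
  qed simp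
  also have "\<dots> < 2 * n" using n by simp
  finally show False using card_edges_sunlet[of n] n by simp
qed

text \<open>From the clockwise half, a shortest route to \<open>Pend 0\<close> crosses
  \<open>Cyc 0\<close> first; from the other half it arrives at vertex 0 from behind, where both are
  equally far.\<close>

lemma Pend_0_diff:
  assumes "i < n"
  shows "int (sunlet_dist n (Cyc i) (Pend 0)) - int (sunlet_dist n (Cyc i) (Cyc 0)) =
      (if 2 * i < n then 1 else 0)"
    and "int (sunlet_dist n (Pend i) (Pend 0)) - int (sunlet_dist n (Pend i) (Cyc 0)) =
      (if i = 0 then -1 else if 2 * i \<le> n then 1 else 0)"
proof -
  have min: "min (Suc (n - i)) i = (if 2 * i \<le> n then i else Suc (n - i))"
    "min i (n - i) = (if 2 * i \<le> n then i else n - i)"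
    "min (Suc i) (n - i) = (if 2 * i < n then Suc i else n - i)"
    using assms by (simp_all add: min_def) linarith+
  show "int (sunlet_dist n (Cyc i) (Pend 0)) - int (sunlet_dist n (Cyc i) (Cyc 0)) =
      (if 2 * i < n then 1 else 0)"
    using assms by (simp add: clockwise_def min min.commute[of "n - i"])
  show "int (sunlet_dist n (Pend i) (Pend 0)) - int (sunlet_dist n (Pend i) (Cyc 0)) =
      (if i = 0 then -1 else if 2 * i \<le> n then 1 else 0)"
    using assms by (simp add: clockwise_def min min.commute[of "n - i"])
qed

text \<open>One place clockwise on the first half is one step away from \<open>Cyc 0\<close> and one
  step towards \<open>Cyc (n div 2)\<close>, so the difference falls by 2; on the other half it
  rises by 2. Pendant edges are shifted by one. \<open>Pend 0\<close> breaks the pattern, but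
  \<open>Pend_0_diff\<close> isolates it.\<close>

lemma Cyc_half_diff:
  assumes "i < n"
  shows "int (sunlet_dist n (Cyc i) (Cyc (n div 2))) - int (sunlet_dist n (Cyc i) (Cyc 0)) =
      (if 2 * i < n then int (n div 2) - 2 * int i else 2 * int i - int (n div 2) - int n)"
    and "i > 0 \<Longrightarrow>
      int (sunlet_dist n (Pend i) (Cyc (n div 2))) - int (sunlet_dist n (Pend i) (Cyc 0)) =
      (if 2 * i \<le> n then int (n div 2) - 2 * int i + 1 else 2 * int i - int (n div 2) - int n - 1)"
proof -
  define h where "h = n div 2"
  \<comment> \<open>Both parities at once: \<open>n\<close> is \<open>2 * h\<close> or
    \<open>2 * h + 1\<close>.\<close>
  have h: "2 * h \<le> n" "n \<le> 2 * h + 1" by (auto simp: h_def)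
  show "int (sunlet_dist n (Cyc i) (Cyc (n div 2))) - int (sunlet_dist n (Cyc i) (Cyc 0)) =
      (if 2 * i < n then int (n div 2) - 2 * int i else 2 * int i - int (n div 2) - int n)"
    using assms h unfolding h_def[symmetric]
    by (cases "i = 0"; cases "i \<le> h"; cases "2 * i < n";
        simp add: clockwise_def min_def of_nat_diff; linarith?)
  show "int (sunlet_dist n (Pend i) (Cyc (n div 2))) - int (sunlet_dist n (Pend i) (Cyc 0)) =
      (if 2 * i \<le> n then int (n div 2) - 2 * int i + 1 else 2 * int i - int (n div 2) - int n - 1)"
    if "i > 0"
    using assms h that unfolding h_def[symmetric]
    by (cases "i \<le> h"; cases "2 * i \<le> n";
        simp add: clockwise_def min_def of_nat_diff; linarith?)
qed

text \<open>The first difference tells on which half of the cycle an edge lies, and isolates \<open>p\<^sub>0\<close>;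
  on each half the second difference is monotone in the position, and its parity separates
  cycle edges from pendant edges.\<close>

lemma sunlet_dist_resolves:
  assumes u: "u \<in> verts (sunlet n)" and v: "v \<in> verts (sunlet n)"
    and pend: "int (sunlet_dist n u (Pend 0)) - int (sunlet_dist n u (Cyc 0)) =
      int (sunlet_dist n v (Pend 0)) - int (sunlet_dist n v (Cyc 0))"
    and cyc: "int (sunlet_dist n u (Cyc (n div 2))) - int (sunlet_dist n u (Cyc 0)) =
      int (sunlet_dist n v (Cyc (n div 2))) - int (sunlet_dist n v (Cyc 0))"
  shows "u = v"
proof -
  have parity: "2 * int a \<noteq> 2 * int b + 1" "2 * int a + 1 \<noteq> 2 * int b" for a b by presburger+
  obtain i where i: "i < n" "u = Cyc i \<or> u = Pend i" using u by (auto simp: verts_sunlet)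
  obtain j where j: "j < n" "v = Cyc j \<or> v = Pend j" using v by (auto simp: verts_sunlet)
  note diffs = Pend_0_diff[OF i(1)] Pend_0_diff[OF j(1)] Cyc_half_diff[OF i(1)] Cyc_half_diff[OF j(1)]
  show ?thesis
    using i(2)
  proof
    assume u: "u = Cyc i"
    show ?thesis using j(2)
    proof
      assume v: "v = Cyc j"
      show ?thesis using pend cyc
        unfolding u v diffs by (simp split: if_splits)
    next
      assume v: "v = Pend j"
      \<comment> \<open>\<open>Pend 0\<close> has first difference -1, a value that no cycle edge
        takes.\<close>
      have "j > 0" using pend unfolding u v diffs by (simp split: if_splits)
      then show ?thesis using pend cyc parity[of i j] parity[of j i]
        unfolding u v diffs(1-6) diffs(8)[OF \<open>j > 0\<close>] by (simp split: if_splits)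
    qed
  next
    assume u: "u = Pend i"
    show ?thesis using j(2)
    proof
      assume v: "v = Cyc j"
      have "i > 0" using pend unfolding u v diffs by (simp split: if_splits)
      then show ?thesis using pend cyc parity[of i j] parity[of j i]
        unfolding u v diffs(1-5,7) diffs(6)[OF \<open>i > 0\<close>] by (simp split: if_splits)
    next
      assume v: "v = Pend j"
      show ?thesis
      proof (cases "i = 0 \<or> j = 0")
        case True
        then show ?thesis using pend unfolding u v diffs by (auto split: if_splits)
      next
        case False
        then have "i > 0" "j > 0" by auto
        then show ?thesis using pend cyc
          unfolding u v diffs(1-5,7) diffs(6)[OF \<open>i > 0\<close>] diffs(8)[OF \<open>j > 0\<close>]
          by (simp split: if_splits)
      qed
    qed
  qed
qed

lemma doubly_resolving_sunlet:
  assumes n: "n \<ge> 4"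
  shows "edge_doubly_resolving_set (sunlet n)
    (sunlet_edge n ` {Cyc 0, Cyc (n div 2), Pend 0})"
  unfolding edge_doubly_resolving_set_def
proof (intro conjI ballI impI)
  let ?L = "{Cyc 0, Cyc (n div 2), Pend 0}"
  have L: "?L \<subseteq> verts (sunlet n)" using n by (auto simp: verts_sunlet)
  then show "sunlet_edge n ` ?L \<subseteq> edges (sunlet n)" by (auto simp: edges_sunlet)
  fix e f assume "e \<in> edges (sunlet n)" "f \<in> edges (sunlet n)" "e \<noteq> f"
  then obtain u v where uv: "u \<in> verts (sunlet n)" "v \<in> verts (sunlet n)" "u \<noteq> v"
      and ef: "e = sunlet_edge n u" "f = sunlet_edge n v" by (auto simp: edges_sunlet)
  \<comment> \<open>Two pairs of landmarks suffice, both measured against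
    \<open>Cyc 0\<close>.\<close>
  have "edge_doubly_resolve (sunlet n) (sunlet_edge n (Pend 0)) (sunlet_edge n (Cyc 0)) e f \<or>
      edge_doubly_resolve (sunlet n) (sunlet_edge n (Cyc (n div 2))) (sunlet_edge n (Cyc 0)) e f"
  proof -
    have "edge_dist (sunlet n) (sunlet_edge n w) (sunlet_edge n z) = sunlet_dist n w z"
      if "w \<in> {u, v}" "z \<in> ?L" for w z
      using that uv L n by (intro edge_dist_sunlet) auto
    then show ?thesis
      using sunlet_dist_resolves[OF uv(1,2)] \<open>u \<noteq> v\<close>
      unfolding edge_doubly_resolve_def ef by (metis insertCI)
  qed
  then show "\<exists>d1\<in>sunlet_edge n ` ?L. \<exists>d2\<in>sunlet_edge n ` ?L.
      edge_doubly_resolve (sunlet n) d1 d2 e f"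
    by blast
qed

theorem theorem2p4:
  fixes n :: nat
  assumes "n \<ge> 4"
  shows "psi_E (sunlet n) = 3"
  unfolding psi_E_def
proof (rule Least_equality)
  let ?L = "{Cyc 0, Cyc (n div 2), Pend 0}"
  have "?L \<subseteq> verts (sunlet n)" using assms by (auto simp: verts_sunlet)
  with assms have "inj_on (sunlet_edge n) ?L"
    by (intro inj_on_subset[OF inj_on_sunlet_edge]) simp_all
  then have "card (sunlet_edge n ` ?L) = card ?L" by (rule card_image)
  also have "\<dots> = 3" using assms by simp
  finally show "\<exists>D. edge_doubly_resolving_set (sunlet n) D \<and> card D = 3"
    using doubly_resolving_sunlet[OF assms] by blast
next
  fix k assume "\<exists>D. edge_doubly_resolving_set (sunlet n) D \<and> card D = k"
  then obtain D where D: "edge_doubly_resolving_set (sunlet n) D" "card D = k" by blast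
  have sub: "D \<subseteq> edges (sunlet n)" using D(1) by (simp add: edge_doubly_resolving_set_def)
  \<comment> \<open>An infinite set has \<open>card\<close> 0, so finiteness is needed to read off
    the shape of \<open>D\<close>.\<close>
  have fin: "finite D"
    using sub card_edges_sunlet(1)[of n] assms by (auto intro: finite_subset)
  show "3 \<le> k"
  proof (rule ccontr)
    assume "\<not> 3 \<le> k"
    \<comment> \<open>Serves as \<open>a\<close> and \<open>b\<close> when \<open>D\<close> is
      empty.\<close>
    have "sunlet_edge n (Cyc 0) \<in> edges (sunlet n)"
      using assms by (auto simp: edges_sunlet verts_sunlet)
    moreover have "card D = 0 \<or> card D = 1 \<or> card D = 2" using D(2) \<open>\<not> 3 \<le> k\<close> by linarith
    then have "D = {} \<or> (\<exists>a b. D = {a, b})"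
      using fin by (metis card_0_eq card_1_singletonE card_2_iff insert_absorb2)
    ultimately have "\<exists>a\<in>edges (sunlet n). \<exists>b\<in>edges (sunlet n). D \<subseteq> {a, b}"
      using sub by blast
    then show False using not_doubly_resolving_pair[OF assms] D(1) by blast
  qed
qed

end
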